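(* Let $n$ be a positive integer, and let $\mathbf{CG}(n)$ and $\mathbf{CG}'(n)$ be the claw graph and its companion. Then $\mathbf{CG}(n)$ and $\mathbf{CG}'(n)$ are TF-cousins if and only if $n$ is odd.
   Context: An undirected edge $\{u,v\}$ is treated as the union of the two arcs $(u,v)$ and $(v,u)$. For graphs $G,H$, a TF-isomorphism (two-fold isomorphism) from $G$ to $H$ is a pair $(\alpha,\beta)$ of bijections $V(G)\to V(H)$ such that, for all $u,v\in V(G)$, $(u,v)$ is an arc of $G$ if and only if $(\alpha(u),\beta(v))$ is an arc of $H$. Graphs $G,H$ are TF-isomorphic if such a pair exists. Two graphs are TF-cousins if they are TF-isomorphic and not isomorphic. For a positive integer $n$, the claw graph $\mathbf{CG}(n)$ is the simple undirected graph on $10n$ vertices defined as follows. Its vertices are circuit vertices $u_0,\dots,u_{6n-1}$, centres $c_i$ for $0\le i<n$, and leaves $\ell_{i,j}$ for $0\le i<n$, $j\in\{0,1,2\}$. Its edges are: - circuit edges $\{u_m,u_{m+1}\}$ for $0\le m<6n$ (indices modulo $6n$), forming a cycle $C_{6n}$; - $\{c_i,\ell_{i,j}\}$ for all $i,j$; - $\{\ell_{i,j},u_{i+jn}\}$ and $\{\ell_{i,j},u_{i+jn+3n}\}$ for all $i,j$ (indices modulo $6n$). The companion $\mathbf{CG}'(n)$ has the same vertices and the same edges, except that the cycle $C_{6n}$ is replaced by two disjoint cycles $C_{3n}$: one on $u_0,u_1,\dots,u_{3n-1}$ (in this cyclic order) and one on $u_{3n},u_{3n+1},\dots,u_{6n-1}$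 (in this cyclic order). *)

theory Defs
  imports "Graph_Theory.Graph_Theory"
begin

section \<open>Two-fold isomorphisms\<close>

text \<open>
  Graphs are represented by vertices and arcs (ordered pairs of vertices). Ordinary isomorphism is
  \<^const>\<open>digraph_iso\<close> of the associated digraphs.
\<close>

definition tf_isomorphism ::
  "'a pair_pre_digraph \<Rightarrow> 'b pair_pre_digraph \<Rightarrow> ('a \<Rightarrow> 'b) \<Rightarrow> ('a \<Rightarrow> 'b) \<Rightarrow> bool" where
  "tf_isomorphism G H \<alpha> \<beta> \<longleftrightarrow>
     bij_betw \<alpha> (pverts G) (pverts H) \<and> bij_betw \<beta> (pverts G) (pverts H) \<and>
     (\<forall>u\<in>pverts G. \<forall>v\<in>pverts G. (u, v) \<in> parcs G \<longleftrightarrow> (\<alpha> u, \<beta> v) \<in> parcs H)"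

definition tf_isomorphic :: "'a pair_pre_digraph \<Rightarrow> 'b pair_pre_digraph \<Rightarrow> bool" where
  "tf_isomorphic G H \<longleftrightarrow> (\<exists>\<alpha> \<beta>. tf_isomorphism G H \<alpha> \<beta>)"

definition tf_cousins :: "'a pair_pre_digraph \<Rightarrow> 'b pair_pre_digraph \<Rightarrow> bool" where
  "tf_cousins G H \<longleftrightarrow> tf_isomorphic G H \<and> \<not> digraph_iso (with_proj G) (with_proj H)"

text \<open>\<^const>\<open>digraph_iso\<close> is stated with a separate map on arcs; without parallel arcs it amounts
  to a bijection of the vertices that preserves and reflects arcs.\<close>

lemma digraph_iso_with_proj_iff:
  assumes G: "pair_wf_digraph G" and H: "pair_wf_digraph H"
  shows "digraph_iso (with_proj G) (with_proj H) \<longleftrightarrow>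
    (\<exists>f. bij_betw f (pverts G) (pverts H) \<and>
      (\<forall>u\<in>pverts G. \<forall>v\<in>pverts G. (u, v) \<in> parcs G \<longleftrightarrow> (f u, f v) \<in> parcs H))"
proof
  assume "digraph_iso (with_proj G) (with_proj H)"
  then obtain h where h: "pre_digraph.digraph_isomorphism (with_proj G) h"
    and eq: "with_proj H = app_iso h (with_proj G)"
    by (auto simp: digraph_iso_def)
  from eq have V: "pverts H = iso_verts h ` pverts G" and A: "parcs H = iso_arcs h ` parcs G"
    and t: "iso_tail h = fst" and d: "iso_head h = snd"
    by (simp_all add: with_proj_def app_iso_def)
  from h have inj: "inj_on (iso_verts h) (pverts G)"
    and arc: "\<And>a. a \<in> parcs G \<Longrightarrow> iso_arcs h a = (iso_verts h (fst a), iso_verts h (snd a))"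
    by (auto simp: pre_digraph.digraph_isomorphism_def t d prod_eq_iff)
  have "(u, v) \<in> parcs G \<longleftrightarrow> (iso_verts h u, iso_verts h v) \<in> parcs H"
    if uv: "u \<in> pverts G" "v \<in> pverts G" for u v
  proof
    assume "(u, v) \<in> parcs G"
    then show "(iso_verts h u, iso_verts h v) \<in> parcs H"
      unfolding A using arc[of "(u, v)"] by (metis fst_conv snd_conv imageI)
  next
    assume "(iso_verts h u, iso_verts h v) \<in> parcs H"
    then obtain a where a: "a \<in> parcs G" "iso_arcs h a = (iso_verts h u, iso_verts h v)"
      unfolding A by auto
    have "fst a \<in> pverts G" "snd a \<in> pverts G"
      using pair_wf_digraph.arc_fst_in_verts[OF G a(1)] pair_wf_digraph.arc_snd_in_verts[OF G a(1)]
      by auto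
    with inj uv a(2) arc[OF a(1)] have "fst a = u" "snd a = v"
      by (auto dest: inj_onD)
    with a(1) show "(u, v) \<in> parcs G" by (metis prod.collapse)
  qed
  with inj V show "\<exists>f. bij_betw f (pverts G) (pverts H) \<and>
      (\<forall>u\<in>pverts G. \<forall>v\<in>pverts G. (u, v) \<in> parcs G \<longleftrightarrow> (f u, f v) \<in> parcs H)"
    by (intro exI[of _ "iso_verts h"]) (auto simp: bij_betw_def)
next
  assume "\<exists>f. bij_betw f (pverts G) (pverts H) \<and>
      (\<forall>u\<in>pverts G. \<forall>v\<in>pverts G. (u, v) \<in> parcs G \<longleftrightarrow> (f u, f v) \<in> parcs H)"
  then obtain f where bij: "bij_betw f (pverts G) (pverts H)"
    and f: "\<And>u v. u \<in> pverts G \<Longrightarrow> v \<in> pverts G \<Longrightarrow> (u, v) \<in> parcs G \<longleftrightarrow> (f u, f v) \<in> parcs H"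
    by auto
  have ends: "fst a \<in> pverts G \<and> snd a \<in> pverts G" if "a \<in> parcs G" for a
    using pair_wf_digraph.arc_fst_in_verts[OF G that] pair_wf_digraph.arc_snd_in_verts[OF G that]
    by simp
  have ends': "fst a \<in> pverts H \<and> snd a \<in> pverts H" if "a \<in> parcs H" for a
    using pair_wf_digraph.arc_fst_in_verts[OF H that] pair_wf_digraph.arc_snd_in_verts[OF H that]
    by simp
  from bij have inj: "inj_on f (pverts G)" and img: "f ` pverts G = pverts H"
    by (auto simp: bij_betw_def)
  have A: "map_prod f f ` parcs G = parcs H"
  proof (intro equalityI subsetI)
    fix a assume "a \<in> map_prod f f ` parcs G"
    then obtain b where "b \<in> parcs G" "a = (f (fst b), f (snd b))"
      by (auto simp: map_prod_def split_beta)
    then show "a \<in> parcs H" using f[of "fst b" "snd b"] ends[of b] by simp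
  next
    fix a assume a: "a \<in> parcs H"
    obtain u v where "u \<in> pverts G" "v \<in> pverts G" "a = (f u, f v)"
    proof -
      from ends'[OF a] have "fst a \<in> f ` pverts G" "snd a \<in> f ` pverts G" by (simp_all add: img)
      then show thesis using that by (metis imageE prod.collapse)
    qed
    then have "(u, v) \<in> parcs G" "a = map_prod f f (u, v)" using a f by simp_all
    then show "a \<in> map_prod f f ` parcs G" by blast
  qed
  let ?h = "\<lparr> iso_verts = f, iso_arcs = map_prod f f, iso_head = snd, iso_tail = fst \<rparr>"
  have "wf_digraph (with_proj G)"
    by (simp add: wf_digraph_def ends)
  moreover have "inj_on (map_prod f f) (parcs G)"
  proof (rule inj_onI)
    fix a b assume "a \<in> parcs G" "b \<in> parcs G" "map_prod f f a = map_prod f f b"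
    then show "a = b"
      using ends[of a] ends[of b] inj
      by (cases a; cases b) (simp add: inj_on_eq_iff)
  qed
  ultimately have "pre_digraph.digraph_isomorphism (with_proj G) ?h"
    using inj by (simp add: pre_digraph.digraph_isomorphism_def)
  moreover have "with_proj H = app_iso ?h (with_proj G)"
    by (simp add: with_proj_def app_iso_def img A)
  ultimately show "digraph_iso (with_proj G) (with_proj H)"
    unfolding digraph_iso_def by blast
qed

section \<open>The claw graph and its companion\<close>

datatype claw_vertex = Circuit nat | Centre nat | Leaf nat nat

definition claw_verts :: "nat \<Rightarrow> claw_vertex set" where
  "claw_verts n = {Circuit m | m. m < 6 * n} \<union> {Centre i | i. i < n}
     \<union> {Leaf i j | i j. i < n \<and> j < 3}"

definition claw_edges :: "nat \<Rightarrow> claw_vertex set set" where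
  "claw_edges n =
       {{Centre i, Leaf i j} | i j. i < n \<and> j < 3}
     \<union> {{Leaf i j, Circuit ((i + j * n) mod (6 * n))} | i j. i < n \<and> j < 3}
     \<union> {{Leaf i j, Circuit ((i + j * n + 3 * n) mod (6 * n))} | i j. i < n \<and> j < 3}"

definition long_circuit_edges :: "nat \<Rightarrow> claw_vertex set set" where
  "long_circuit_edges n = {{Circuit m, Circuit ((m + 1) mod (6 * n))} | m. m < 6 * n}"

definition two_circuits_edges :: "nat \<Rightarrow> claw_vertex set set" where
  "two_circuits_edges n =
       {{Circuit m, Circuit ((m + 1) mod (3 * n))} | m. m < 3 * n}
     \<union> {{Circuit (3 * n + m), Circuit (3 * n + (m + 1) mod (3 * n))} | m. m < 3 * n}"

definition undirected_graph :: "'a set \<Rightarrow> 'a set set \<Rightarrow> 'a pair_pre_digraph" where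
  "undirected_graph V E = \<lparr> pverts = V, parcs = {(u, v). {u, v} \<in> E} \<rparr>"

definition CG :: "nat \<Rightarrow> claw_vertex pair_pre_digraph" where
  "CG n = undirected_graph (claw_verts n) (long_circuit_edges n \<union> claw_edges n)"

definition CG' :: "nat \<Rightarrow> claw_vertex pair_pre_digraph" where
  "CG' n = undirected_graph (claw_verts n) (two_circuits_edges n \<union> claw_edges n)"

lemma card_claw_verts: "finite (claw_verts n)" "card (claw_verts n) = 10 * n"
proof -
  have eq: "claw_verts n =
    Circuit ` {..<6 * n} \<union> (Centre ` {..<n} \<union> (\<lambda>(i, j). Leaf i j) ` ({..<n} \<times> {..<3}))"
    by (auto simp: claw_verts_def)
  show "finite (claw_verts n)" unfolding eq by simp
  show "card (claw_verts n) = 10 * n"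
    unfolding eq
    by (subst card_Un_disjoint; (subst card_Un_disjoint)?)
       (auto simp: card_image inj_on_def)
qed

lemma pair_graph_undirected_graph:
  assumes V: "finite V" and E: "\<And>e. e \<in> E \<Longrightarrow> e \<subseteq> V \<and> card e = 2"
  shows "pair_graph (undirected_graph V E)"
proof -
  have sub: "parcs (undirected_graph V E) \<subseteq> V \<times> V"
    using E by (fastforce simp: undirected_graph_def)
  have fin: "finite (parcs (undirected_graph V E))"
    using finite_subset[OF sub] V by blast
  show ?thesis
  proof unfold_locales
    fix e assume e: "e \<in> parcs (undirected_graph V E)"
    then show "fst e \<in> pverts (undirected_graph V E)" "snd e \<in> pverts (undirected_graph V E)"
      using sub by (auto simp: undirected_graph_def)
    show "fst e \<noteq> snd e" using e E by (force simp: undirected_graph_def)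
  next
    show "finite (pverts (undirected_graph V E))" using V by (simp add: undirected_graph_def)
    show "finite (parcs (undirected_graph V E))" by (fact fin)
    show "symmetric (with_proj (undirected_graph V E))"
      by (auto simp: symmetric_def undirected_graph_def sym_def insert_commute)
  qed
qed

lemma mod_Suc_neq: "m < k \<Longrightarrow> 1 < k \<Longrightarrow> (m + 1) mod k \<noteq> (m::nat)"
  by (cases "m + 1 = k") auto

lemma pair_graph_CG:
  assumes n: "n > 0"
  shows "pair_graph (CG n)" "pair_graph (CG' n)"
proof -
  have claw: "e \<subseteq> claw_verts n \<and> card e = 2" if "e \<in> claw_edges n" for e
    using that n by (auto simp: claw_edges_def claw_verts_def)
  have long: "e \<subseteq> claw_verts n \<and> card e = 2" if "e \<in> long_circuit_edges n" for e
  proof -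
    from that obtain m where e: "e = {Circuit m, Circuit ((m + 1) mod (6 * n))}" "m < 6 * n"
      by (auto simp: long_circuit_edges_def)
    have "(m + 1) mod (6 * n) \<noteq> m" using mod_Suc_neq[of m "6 * n"] e n by simp
    moreover have "(m + 1) mod (6 * n) < 6 * n" using n by simp
    ultimately show ?thesis using e by (auto simp: claw_verts_def card_insert_if)
  qed
  have two: "e \<subseteq> claw_verts n \<and> card e = 2" if "e \<in> two_circuits_edges n" for e
  proof -
    from that obtain m where m: "m < 3 * n"
      and e: "e = {Circuit m, Circuit ((m + 1) mod (3 * n))} \<or>
        e = {Circuit (3 * n + m), Circuit (3 * n + (m + 1) mod (3 * n))}"
      by (auto simp: two_circuits_edges_def)
    have "(m + 1) mod (3 * n) \<noteq> m" using mod_Suc_neq[of m "3 * n"] m n by simp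
    moreover have "(m + 1) mod (3 * n) < 3 * n" "(m + 1) mod (3 * n) < 6 * n"
      using mod_less_divisor[of "3 * n" "m + 1"] n by linarith+
    ultimately show ?thesis using e m by (auto simp: claw_verts_def card_insert_if)
  qed
  show "pair_graph (CG n)" "pair_graph (CG' n)"
    unfolding CG_def CG'_def using claw long two
    by (auto intro!: pair_graph_undirected_graph card_claw_verts(1))
qed

end

theory Submission
  imports Defs "HOL-Number_Theory.Cong"
begin

text \<open>
  For odd \<open>n\<close> the long circuit is wrapped around the two short ones: sending \<open>u\<^sub>k\<close> to the vertex with
  residue \<open>k mod 3n\<close> on the short circuit selected by the parity of \<open>k\<close> (for \<open>\<alpha>\<close>) or of \<open>k + 1\<close> (for
  \<open>\<beta>\<close>), and fixing leaves and centres, gives a TF-isomorphism.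

  For the remaining claims, count pairs \<open>(f, g)\<close> of labellings of the vertices by \<open>0, 1, 2\<close> such that
  modulo 3 the label \<open>g v\<close> cancels the sum of \<open>f\<close> over the neighbours of \<open>v\<close>, and vice versa. A
  TF-isomorphism preserves the number of such pairs, and an isomorphism also the number of those with
  \<open>f = g\<close>. The differences \<open>x\<^sub>k = f u\<^sub>k - f u\<^bsub>k+3n\<^esub>\<close> and \<open>y\<^sub>k = g u\<^sub>k - g u\<^bsub>k+3n\<^esub>\<close> do not see the
  leaves, and on the long circuit they satisfy \<open>x\<^bsub>k+3\<^esub> = y\<^sub>k\<close> and \<open>y\<^bsub>k+3\<^esub> = x\<^sub>k\<close> modulo 3. If \<open>n\<close> is
  even or \<open>f = g\<close>, then \<open>x\<^sub>k = x\<^bsub>k+3n\<^esub> = -x\<^sub>k\<close>, so \<open>f\<close> and \<open>g\<close> are constant on antipodal pairs and hence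
  the pair \<open>(f, g)\<close> is also a solution on the companion. The companion has a further solution: 1 on
  one short circuit, 2 on the other and 0 elsewhere.
\<close>

section \<open>Cyclic coordinates for the vertices\<close>

text \<open>\<open>circ n k\<close> is \<open>u\<^sub>k\<close>, \<open>pos n a k\<close> is the \<open>k\<close>-th vertex of the \<open>a\<close>-th short circuit, with all indices
  read cyclically, and \<open>foot n k\<close> is the leaf attached to \<open>u\<^sub>k\<close>.\<close>

definition circ :: "nat \<Rightarrow> nat \<Rightarrow> claw_vertex" where
  "circ n k = Circuit (k mod (6 * n))"

definition pos :: "nat \<Rightarrow> nat \<Rightarrow> nat \<Rightarrow> claw_vertex" where
  "pos n a k = Circuit (3 * n * (a mod 2) + k mod (3 * n))"

definition foot :: "nat \<Rightarrow> nat \<Rightarrow> claw_vertex" where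
  "foot n k = Leaf (k mod n) (k mod (3 * n) div n)"

lemma circ_eq_iff: "circ n k = circ n l \<longleftrightarrow> k mod (6 * n) = l mod (6 * n)"
  by (simp add: circ_def)

text \<open>Quotient and remainder by \<open>3 * n\<close> recover the short circuit and the
  position on it.\<close>

lemma pos_eq_iff:
  assumes "n > 0"
  shows "pos n a k = pos n b l \<longleftrightarrow> a mod 2 = b mod 2 \<and> k mod (3 * n) = l mod (3 * n)"
proof
  have split: "(3 * n * q + r) div (3 * n) = q" "(3 * n * q + r) mod (3 * n) = r" if "r < 3 * n" for q r
    using that by auto
  assume "pos n a k = pos n b l"
  then have eq: "3 * n * (a mod 2) + k mod (3 * n) = 3 * n * (b mod 2) + l mod (3 * n)"
    by (simp add: pos_def)
  have "k mod (3 * n) < 3 * n" "l mod (3 * n) < 3 * n" using assms by simp_all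
  with eq show "a mod 2 = b mod 2 \<and> k mod (3 * n) = l mod (3 * n)" by (metis split)
qed (simp add: pos_def)

lemma foot_add_half [simp]: "foot n (k + 3 * n) = foot n k"
  by (simp add: foot_def)

lemma foot_cong: "k mod (3 * n) = l mod (3 * n) \<Longrightarrow> foot n k = foot n l"
  unfolding foot_def by (metis dvd_triv_right mod_mod_cancel)

lemma circ_add_full [simp]: "circ n (k + 6 * n) = circ n k"
  by (simp add: circ_def)

lemma circ_eq_pos:
  assumes "n > 0"
  shows "\<exists>a. circ n k = pos n a k"
proof -
  have "k mod (6 * n) = 3 * n * (k div (3 * n) mod 2) + k mod (3 * n)"
    using mod_mult2_eq[of k "3 * n" 2] by (simp add: ac_simps)
  then show ?thesis by (auto simp: circ_def pos_def)
qed

text \<open>The index \<open>l\<close> may differ from \<open>k\<close> by half a turn of the long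
  circuit. Its residue modulo \<open>3 * n\<close> is kept because this is all that
  \<open>foot\<close> depends on.\<close>

lemma pos_eq_circ:
  assumes "n > 0"
  obtains l where "pos n a k = circ n l" "l mod (3 * n) = k mod (3 * n)"
proof
  have "k mod (3 * n) < 3 * n" using assms by simp
  then have "3 * n * (a mod 2) + k mod (3 * n) < 6 * n" by (cases "a mod 2 = 0") auto
  then show "pos n a k = circ n (3 * n * (a mod 2) + k mod (3 * n))"
    by (simp add: pos_def circ_def)
  show "(3 * n * (a mod 2) + k mod (3 * n)) mod (3 * n) = k mod (3 * n)" by simp
qed

lemma circuit_eq_circ: "m < 6 * n \<Longrightarrow> Circuit m = circ n m"
  by (simp add: circ_def)

lemma leaf_eq_foot:
  assumes "i < n" "j < 3"
  shows "Leaf i j = foot n (i + j * n)"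
proof -
  have "j * n \<le> 2 * n" using assms by simp
  then have "i + j * n < 3 * n" using assms by linarith
  with assms show ?thesis by (simp add: foot_def)
qed

lemma foot_in_leaves:
  fixes n :: nat
  assumes "n > 0"
  shows "k mod n < n" "k mod (3 * n) div n < 3"
  using assms by (simp_all add: div_less_iff_less_mult)

lemma claw_verts_eq:
  assumes "n > 0"
  shows "claw_verts n = range (circ n) \<union> range (foot n) \<union> Centre ` {..<n}"
proof (intro equalityI subsetI)
  fix v assume "v \<in> claw_verts n"
  then show "v \<in> range (circ n) \<union> range (foot n) \<union> Centre ` {..<n}"
    by (auto simp: claw_verts_def circuit_eq_circ[of _ n] leaf_eq_foot[of _ n])
next
  fix v assume "v \<in> range (circ n) \<union> range (foot n) \<union> Centre ` {..<n}"
  then show "v \<in> claw_verts n"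
    using assms by (auto simp: claw_verts_def circ_def foot_def foot_in_leaves)
qed

section \<open>Edges in cyclic coordinates\<close>

text \<open>Letting the index run over all naturals removes the special case of the wrap-around
  edge.\<close>

lemma long_circuit_edges_eq:
  assumes "n > 0"
  shows "long_circuit_edges n = {{circ n k, circ n (k + 1)} | k. True}"
proof (intro equalityI subsetI)
  fix e assume "e \<in> long_circuit_edges n"
  then show "e \<in> {{circ n k, circ n (k + 1)} | k. True}"
    by (auto simp: long_circuit_edges_def circ_def) (metis mod_less)
next
  fix e assume "e \<in> {{circ n k, circ n (k + 1)} | k. True}"
  then obtain k where e: "e = {circ n k, circ n (k + 1)}" by auto
  have "k mod (6 * n) < 6 * n" "circ n (k + 1) = Circuit ((k mod (6 * n) + 1) mod (6 * n))"
    using assms by (simp_all add: circ_def mod_Suc_eq)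
  then show "e \<in> long_circuit_edges n"
    unfolding long_circuit_edges_def e mem_Collect_eq
    by (intro exI[of _ "k mod (6 * n)"]) (simp add: circ_def)
qed

lemma two_circuits_edges_eq:
  assumes "n > 0"
  shows "two_circuits_edges n = {{pos n a k, pos n a (k + 1)} | a k. True}"
proof (intro equalityI subsetI)
  fix e assume "e \<in> two_circuits_edges n"
  then obtain m where m: "m < 3 * n"
    and "e = {Circuit m, Circuit ((m + 1) mod (3 * n))} \<or>
      e = {Circuit (3 * n + m), Circuit (3 * n + (m + 1) mod (3 * n))}"
    by (auto simp: two_circuits_edges_def)
  then have "e = {pos n 0 m, pos n 0 (m + 1)} \<or> e = {pos n 1 m, pos n 1 (m + 1)}"
    by (simp add: pos_def)
  then show "e \<in> {{pos n a k, pos n a (k + 1)} | a k. True}" by blast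
next
  fix e assume "e \<in> {{pos n a k, pos n a (k + 1)} | a k. True}"
  then obtain a k where e: "e = {pos n a k, pos n a (k + 1)}" by auto
  have m: "k mod (3 * n) < 3 * n"
    and s: "(k + 1) mod (3 * n) = (k mod (3 * n) + 1) mod (3 * n)"
    using assms by (simp_all add: mod_Suc_eq)
  show "e \<in> two_circuits_edges n"
  proof (cases "a mod 2 = 0")
    case True
    then show ?thesis using m unfolding e pos_def s two_circuits_edges_def by auto
  next
    case False
    then have "a mod 2 = 1" by simp
    then show ?thesis using m unfolding e pos_def s two_circuits_edges_def by auto
  qed
qed

text \<open>The numbers \<open>i + j * n\<close> with \<open>i < n\<close> and \<open>j < 3\<close>
  run once through the residues modulo \<open>3 * n\<close>, so each leaf is joined to one vertex on
  each short circuit, at the same position.\<close>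

lemma claw_edges_eq_pos:
  assumes "n > 0"
  shows "claw_edges n = {{Centre i, Leaf i j} | i j. i < n \<and> j < 3} \<union> {{foot n k, pos n a k} | a k. True}"
proof -
  have lt: "i + j * n < 3 * n" if "i < n" "j < 3" for i j
  proof -
    have "j * n \<le> 2 * n" using that by simp
    then show ?thesis using that by linarith
  qed
  have 0: "Circuit ((i + j * n) mod (6 * n)) = pos n 0 (i + j * n)"
    and 1: "Circuit ((i + j * n + 3 * n) mod (6 * n)) = pos n 1 (i + j * n)"
    if "i < n" "j < 3" for i j
    using lt[OF that] by (simp_all add: pos_def)
  have foot: "\<exists>i j. i < n \<and> j < 3 \<and> foot n k = Leaf i j \<and> pos n a k = pos n a (i + j * n)" for a k
  proof (intro exI conjI)
    show "k mod n < n" "k mod (3 * n) div n < 3" using foot_in_leaves[OF assms] by auto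
    have "k mod n = k mod (3 * n) mod n" by (simp add: mod_mod_cancel)
    then have "k mod n + k mod (3 * n) div n * n = k mod (3 * n)" by (metis mod_div_mult_eq)
    then show "pos n a k = pos n a (k mod n + k mod (3 * n) div n * n)" by (simp add: pos_def)
  qed (simp add: foot_def)
  have "{{foot n k, pos n a k} | a k. True} =
      {{Leaf i j, pos n 0 (i + j * n)} | i j. i < n \<and> j < 3} \<union>
      {{Leaf i j, pos n 1 (i + j * n)} | i j. i < n \<and> j < 3}" (is "?L = ?R")
  proof (intro equalityI subsetI)
    fix e assume "e \<in> ?L"
    then obtain a k where "e = {foot n k, pos n a k}" by auto
    moreover have "pos n a k = pos n 0 k \<or> pos n a k = pos n 1 k"
      by (cases "even a") (simp_all add: pos_def odd_iff_mod_2_eq_one)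
    ultimately show "e \<in> ?R" using foot[of k 0] foot[of k 1] by auto
  next
    fix e assume "e \<in> ?R"
    then obtain i j b where "i < n" "j < 3" "e = {Leaf i j, pos n b (i + j * n)}" by blast
    then have "e = {foot n (i + j * n), pos n b (i + j * n)}" using leaf_eq_foot[of i n j] by simp
    then show "e \<in> ?L" by blast
  qed
  moreover have "{{Leaf i j, Circuit ((i + j * n) mod (6 * n))} | i j. i < n \<and> j < 3} =
      {{Leaf i j, pos n 0 (i + j * n)} | i j. i < n \<and> j < 3}"
    using 0 by (intro Collect_cong) metis
  moreover have "{{Leaf i j, Circuit ((i + j * n + 3 * n) mod (6 * n))} | i j. i < n \<and> j < 3} =
      {{Leaf i j, pos n 1 (i + j * n)} | i j. i < n \<and> j < 3}"
    using 1 by (intro Collect_cong) metis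
  ultimately show ?thesis unfolding claw_edges_def by (simp only: Un_assoc)
qed

lemma claw_edges_eq_circ:
  assumes "n > 0"
  shows "claw_edges n = {{Centre i, Leaf i j} | i j. i < n \<and> j < 3} \<union> {{foot n k, circ n k} | k. True}"
proof -
  have "{{foot n k, pos n a k} | a k. True} = {{foot n k, circ n k} | k. True}"
  proof (intro equalityI subsetI)
    fix e assume "e \<in> {{foot n k, pos n a k} | a k. True}"
    then obtain a k where e: "e = {foot n k, pos n a k}" by auto
    obtain l where "pos n a k = circ n l" "l mod (3 * n) = k mod (3 * n)"
      using pos_eq_circ[OF assms] by blast
    then have "e = {foot n l, circ n l}" using e foot_cong[of l n k] by simp
    then show "e \<in> {{foot n k, circ n k} | k. True}" by blast
  next
    fix e assume "e \<in> {{foot n k, circ n k} | k. True}"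
    then obtain k where "e = {foot n k, circ n k}" by auto
    moreover obtain a where "circ n k = pos n a k" using circ_eq_pos[OF assms] by blast
    ultimately show "e \<in> {{foot n k, pos n a k} | a k. True}" by auto
  qed
  then show ?thesis using claw_edges_eq_pos[OF assms] by simp
qed

lemma parcs_CG:
  assumes "n > 0"
  shows "(u, v) \<in> parcs (CG n) \<longleftrightarrow>
    (\<exists>k. {u, v} = {circ n k, circ n (k + 1)}) \<or> (\<exists>i j. i < n \<and> j < 3 \<and> {u, v} = {Centre i, Leaf i j})
      \<or> (\<exists>k. {u, v} = {foot n k, circ n k})"
  by (auto simp: CG_def undirected_graph_def long_circuit_edges_eq[OF assms] claw_edges_eq_circ[OF assms])

lemma parcs_CG':
  assumes "n > 0"
  shows "(u, v) \<in> parcs (CG' n) \<longleftrightarrow>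
    (\<exists>a k. {u, v} = {pos n a k, pos n a (k + 1)}) \<or> (\<exists>i j. i < n \<and> j < 3 \<and> {u, v} = {Centre i, Leaf i j})
      \<or> (\<exists>a k. {u, v} = {foot n k, pos n a k})"
  by (auto simp: CG'_def undirected_graph_def two_circuits_edges_eq[OF assms] claw_edges_eq_pos[OF assms])

lemma pverts_CG [simp]: "pverts (CG n) = claw_verts n" "pverts (CG' n) = claw_verts n"
  by (simp_all add: CG_def CG'_def undirected_graph_def)

lemma claw_vertex_distinct [simp]:
  "circ n k \<noteq> foot n l" "foot n l \<noteq> circ n k" "circ n k \<noteq> Centre i" "Centre i \<noteq> circ n k"
  "circ n k \<noteq> Leaf i j" "Leaf i j \<noteq> circ n k"
  "pos n a k \<noteq> foot n l" "foot n l \<noteq> pos n a k" "pos n a k \<noteq> Centre i" "Centre i \<noteq> pos n a k"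
  "pos n a k \<noteq> Leaf i j" "Leaf i j \<noteq> pos n a k" "foot n k \<noteq> Centre i" "Centre i \<noteq> foot n k"
  by (simp_all add: circ_def pos_def foot_def)

lemma mod_add_cancel: "(k + c) mod m = (l + c) mod m \<longleftrightarrow> k mod m = l mod (m :: nat)"
  using cong_add_rcancel_nat[of k c l m] unfolding cong_def .

section \<open>Neighbourhoods and sums over them\<close>

text \<open>Centring at \<open>k + 1\<close> gives the predecessor an index without subtraction on
  naturals.\<close>

lemma neighbours_circ:
  assumes "n > 0"
  shows "{w. (circ n (k + 1), w) \<in> parcs (CG n)} = {circ n k, circ n (k + 2), foot n (k + 1)}"
proof -
  have shift: "circ n (k + 1) = circ n (l + 1) \<longleftrightarrow> circ n k = circ n l" for l
    using mod_add_cancel[of k 1 "6 * n" l] by (simp only: circ_eq_iff)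
  have next': "circ n (l + 1) = circ n (k + 2)" if "circ n (k + 1) = circ n l" for l
    using that mod_add_cancel[of "k + 1" 1 "6 * n" l] by (simp add: circ_eq_iff eval_nat_numeral)
  have foot': "foot n l = foot n (k + 1)" if "circ n (k + 1) = circ n l" for l
  proof (rule foot_cong)
    have "3 * n dvd 6 * n" by (simp add: mult_dvd_mono)
    then show "l mod (3 * n) = (k + 1) mod (3 * n)"
      using that unfolding circ_eq_iff by (metis mod_mod_cancel)
  qed
  show ?thesis
  proof (intro equalityI subsetI)
    fix w assume "w \<in> {w. (circ n (k + 1), w) \<in> parcs (CG n)}"
    then consider (edge) l where "{circ n (k + 1), w} = {circ n l, circ n (l + 1)}"
      | (leaf) l where "{circ n (k + 1), w} = {foot n l, circ n l}"
      unfolding mem_Collect_eq parcs_CG[OF assms] by (auto simp: doubleton_eq_iff)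
    then show "w \<in> {circ n k, circ n (k + 2), foot n (k + 1)}"
    proof cases
      case edge
      then consider "circ n (k + 1) = circ n l" "w = circ n (l + 1)" | "circ n (k + 1) = circ n (l + 1)" "w = circ n l"
        by (auto simp: doubleton_eq_iff)
      then show ?thesis
      proof cases
        case 1
        with next'[of l] have "w = circ n (k + 2)" by (simp only:)
        then show ?thesis by blast
      next
        case 2
        with shift[of l] have "w = circ n k" by metis
        then show ?thesis by blast
      qed
    next
      case leaf
      then show ?thesis using foot'[of l] by (auto simp: doubleton_eq_iff)
    qed
  next
    have "{circ n (k + 1), circ n (k + 2)} = {circ n (k + 1), circ n (k + 1 + 1)}" by simp
    moreover fix w assume "w \<in> {circ n k, circ n (k + 2), foot n (k + 1)}"
    ultimately show "w \<in> {w. (circ n (k + 1), w) \<in> parcs (CG n)}"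
      unfolding mem_Collect_eq parcs_CG[OF assms] by blast
  qed
qed

lemma neighbours_pos:
  assumes "n > 0"
  shows "{w. (pos n a (k + 1), w) \<in> parcs (CG' n)} = {pos n a k, pos n a (k + 2), foot n (k + 1)}"
proof -
  have shift: "pos n a (k + 1) = pos n b (l + 1) \<longleftrightarrow> pos n a k = pos n b l" for b l
    using mod_add_cancel[of k 1 "3 * n" l] by (simp only: pos_eq_iff[OF assms])
  have next': "pos n b (l + 1) = pos n a (k + 2)" if "pos n a (k + 1) = pos n b l" for b l
    using that mod_add_cancel[of "k + 1" 1 "3 * n" l] by (simp add: pos_eq_iff[OF assms] eval_nat_numeral)
  have foot': "foot n l = foot n (k + 1)" if "pos n a (k + 1) = pos n b l" for b l
    using that foot_cong[of "k + 1" n l] by (simp add: pos_eq_iff[OF assms])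
  show ?thesis
  proof (intro equalityI subsetI)
    fix w assume "w \<in> {w. (pos n a (k + 1), w) \<in> parcs (CG' n)}"
    then consider (edge) b l where "{pos n a (k + 1), w} = {pos n b l, pos n b (l + 1)}"
      | (leaf) b l where "{pos n a (k + 1), w} = {foot n l, pos n b l}"
      unfolding mem_Collect_eq parcs_CG'[OF assms] by (auto simp: doubleton_eq_iff)
    then show "w \<in> {pos n a k, pos n a (k + 2), foot n (k + 1)}"
    proof cases
      case edge
      then consider "pos n a (k + 1) = pos n b l" "w = pos n b (l + 1)" | "pos n a (k + 1) = pos n b (l + 1)" "w = pos n b l"
        by (auto simp: doubleton_eq_iff)
      then show ?thesis
      proof cases
        case 1
        with next'[of b l] have "w = pos n a (k + 2)" by (simp only:)
        then show ?thesis by blast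
      next
        case 2
        with shift[of b l] have "w = pos n a k" by metis
        then show ?thesis by blast
      qed
    next
      case leaf
      then show ?thesis using foot'[of b l] by (auto simp: doubleton_eq_iff)
    qed
  next
    have "{pos n a (k + 1), pos n a (k + 2)} = {pos n a (k + 1), pos n a (k + 1 + 1)}" by simp
    moreover fix w assume "w \<in> {pos n a k, pos n a (k + 2), foot n (k + 1)}"
    ultimately show "w \<in> {w. (pos n a (k + 1), w) \<in> parcs (CG' n)}"
      unfolding mem_Collect_eq parcs_CG'[OF assms] by blast
  qed
qed

lemma neighbours_foot:
  assumes "n > 0"
  shows "{w. (foot n k, w) \<in> parcs (CG' n)} = {Centre (k mod n), pos n 0 k, pos n 1 k}"
proof (intro equalityI subsetI)
  fix w assume "w \<in> {w. (foot n k, w) \<in> parcs (CG' n)}"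
  then consider (centre) i j where "{foot n k, w} = {Centre i, Leaf i j}"
    | (circuit) a l where "{foot n k, w} = {foot n l, pos n a l}"
    unfolding mem_Collect_eq parcs_CG'[OF assms] by (auto simp: doubleton_eq_iff)
  then show "w \<in> {Centre (k mod n), pos n 0 k, pos n 1 k}"
  proof cases
    case centre
    then show ?thesis by (auto simp: doubleton_eq_iff foot_def)
  next
    case circuit
    then have w: "w = pos n a l" and eq: "foot n k = foot n l" by (auto simp: doubleton_eq_iff)
    \<comment> \<open>The coordinates of a leaf are the base-\<open>n\<close> digits of the index
      modulo \<open>3 * n\<close>, so the leaf determines that residue.\<close>
    have "m mod (3 * n) = m mod (3 * n) div n * n + m mod n" for m
      by (metis div_mult_mod_eq dvd_triv_right mod_mod_cancel)
    then have "k mod (3 * n) = l mod (3 * n)" using eq by (metis foot_def claw_vertex.inject(3))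
    with w have "w = pos n a k" by (simp add: pos_def)
    then show ?thesis by (cases "even a") (simp_all add: pos_def odd_iff_mod_2_eq_one)
  qed
next
  have "k mod n < n" "k mod (3 * n) div n < 3" "foot n k = Leaf (k mod n) (k mod (3 * n) div n)"
    using foot_in_leaves[OF assms] by (simp_all add: foot_def)
  then have "\<exists>i j. i < n \<and> j < 3 \<and> {foot n k, Centre (k mod n)} = {Centre i, Leaf i j}"
    by (metis insert_commute)
  moreover fix w assume "w \<in> {Centre (k mod n), pos n 0 k, pos n 1 k}"
  ultimately show "w \<in> {w. (foot n k, w) \<in> parcs (CG' n)}"
    unfolding mem_Collect_eq parcs_CG'[OF assms] by blast
qed

text \<open>The two graphs differ only in edges between circuit vertices.\<close>

lemma neighbours_CG'_eq_CG:
  assumes "v \<notin> range Circuit"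
  shows "{w. (v, w) \<in> parcs (CG' n)} = {w. (v, w) \<in> parcs (CG n)}"
  using assms
  by (auto simp: CG_def CG'_def undirected_graph_def long_circuit_edges_def two_circuits_edges_def
      doubleton_eq_iff)

text \<open>Ensures that the two circuit neighbours of a vertex are distinct, so that a sum over the
  neighbourhood has three separate terms.\<close>

lemma mod_add_2_neq: "m > 2 \<Longrightarrow> k mod m \<noteq> (k + 2) mod (m :: nat)"
  using cong_add_lcancel_0_nat[of k 2 m] by (auto simp: cong_def)

lemma sum_neighbours_circ:
  fixes f :: "claw_vertex \<Rightarrow> int"
  assumes "n > 0"
  shows "(\<Sum>w | (circ n (k + 1), w) \<in> parcs (CG n). f w)
    = f (circ n k) + f (circ n (k + 2)) + f (foot n (k + 1))"
proof -
  have "circ n k \<noteq> circ n (k + 2)" using mod_add_2_neq[of "6 * n" k] assms by (simp only: circ_eq_iff) simp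
  then show ?thesis unfolding neighbours_circ[OF assms] by simp
qed

lemma sum_neighbours_pos:
  fixes f :: "claw_vertex \<Rightarrow> int"
  assumes "n > 0"
  shows "(\<Sum>w | (pos n a (k + 1), w) \<in> parcs (CG' n). f w)
    = f (pos n a k) + f (pos n a (k + 2)) + f (foot n (k + 1))"
proof -
  have "pos n a k \<noteq> pos n a (k + 2)"
    using mod_add_2_neq[of "3 * n" k] assms by (simp only: pos_eq_iff[OF assms]) simp
  then show ?thesis unfolding neighbours_pos[OF assms] by simp
qed

section \<open>Balanced pairs modulo 3 as an invariant\<close>

text \<open>With \<open>A\<close> the adjacency matrix of a finite graph this reads
  \<open>g + A f = 0\<close> modulo 3. Pairs balanced in both orders form the kernel modulo 3 of the
  identity plus the adjacency matrix of the canonical double cover; those with \<open>f = g\<close>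
  correspond to the kernel of \<open>A + I\<close>.\<close>

definition balanced :: "'a pair_pre_digraph \<Rightarrow> ('a \<Rightarrow> int) \<Rightarrow> ('a \<Rightarrow> int) \<Rightarrow> bool" where
  "balanced G f g \<longleftrightarrow> (\<forall>v\<in>pverts G. 3 dvd g v + (\<Sum>w | (v, w) \<in> parcs G. f w))"

text \<open>Extensional functions into fixed representatives modulo 3 make the set finite, so that
  it can be counted. The flag \<open>d\<close> restricts it to the diagonal.\<close>

definition balanced_pairs :: "'a pair_pre_digraph \<Rightarrow> bool \<Rightarrow> (('a \<Rightarrow> int) \<times> ('a \<Rightarrow> int)) set" where
  "balanced_pairs G d = {(f, g). f \<in> pverts G \<rightarrow>\<^sub>E {0, 1, 2} \<and> g \<in> pverts G \<rightarrow>\<^sub>E {0, 1, 2} \<and>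
     balanced G f g \<and> balanced G g f \<and> (d \<longrightarrow> f = g)}"

lemma finite_balanced_pairs:
  assumes "finite (pverts G)"
  shows "finite (balanced_pairs G d)"
proof (rule finite_subset)
  show "balanced_pairs G d \<subseteq> (pverts G \<rightarrow>\<^sub>E {0, 1, 2}) \<times> (pverts G \<rightarrow>\<^sub>E {0, 1, 2})"
    by (auto simp: balanced_pairs_def)
qed (use assms in \<open>auto intro!: finite_PiE\<close>)

text \<open>The neighbours of \<open>\<alpha> v\<close> are the images under \<open>\<beta>\<close>
  of the neighbours of \<open>v\<close>. Hence the summed labelling is pulled back along
  \<open>\<beta>\<close> and the labelling read at the vertex itself along
  \<open>\<alpha>\<close>.\<close>

lemma balanced_pullback:
  assumes iso: "tf_isomorphism G H \<alpha> \<beta>"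
    and G: "parcs G \<subseteq> pverts G \<times> pverts G" and H: "parcs H \<subseteq> pverts H \<times> pverts H"
    and fg: "balanced H f g"
  shows "balanced G (restrict (f \<circ> \<beta>) (pverts G)) (restrict (g \<circ> \<alpha>) (pverts G))"
  unfolding balanced_def
proof
  fix v assume v: "v \<in> pverts G"
  have \<alpha>: "\<alpha> v \<in> pverts H" using iso v by (auto simp: tf_isomorphism_def bij_betw_def)
  have inj: "inj_on \<beta> (pverts G)" and img: "\<beta> ` pverts G = pverts H"
    using iso by (auto simp: tf_isomorphism_def bij_betw_def)
  have arcs: "(v, w) \<in> parcs G \<longleftrightarrow> (\<alpha> v, \<beta> w) \<in> parcs H" if "w \<in> pverts G" for w
    using iso v that by (simp add: tf_isomorphism_def)
  have N: "{w. (\<alpha> v, w) \<in> parcs H} = \<beta> ` {w. (v, w) \<in> parcs G}"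
  proof (intro equalityI subsetI)
    fix w assume w: "w \<in> {w. (\<alpha> v, w) \<in> parcs H}"
    then have "w \<in> \<beta> ` pverts G" using H img by auto
    then obtain x where "x \<in> pverts G" "w = \<beta> x" by blast
    with w arcs show "w \<in> \<beta> ` {w. (v, w) \<in> parcs G}" by auto
  next
    fix w assume "w \<in> \<beta> ` {w. (v, w) \<in> parcs G}"
    then show "w \<in> {w. (\<alpha> v, w) \<in> parcs H}" using G arcs by auto
  qed
  have sub: "{w. (v, w) \<in> parcs G} \<subseteq> pverts G" using G by auto
  have "(\<Sum>w | (\<alpha> v, w) \<in> parcs H. f w) = (\<Sum>w | (v, w) \<in> parcs G. f (\<beta> w))"
    unfolding N using inj_on_subset[OF inj sub] by (simp add: sum.reindex)
  also have "\<dots> = (\<Sum>w | (v, w) \<in> parcs G. restrict (f \<circ> \<beta>) (pverts G) w)"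
    using sub by (intro sum.cong) auto
  finally show "3 dvd restrict (g \<circ> \<alpha>) (pverts G) v
      + (\<Sum>w | (v, w) \<in> parcs G. restrict (f \<circ> \<beta>) (pverts G) w)"
    using fg \<alpha> v by (auto simp: balanced_def)
qed

lemma tf_isomorphism_swap:
  assumes "tf_isomorphism G H \<alpha> \<beta>" "sym (parcs G)" "sym (parcs H)"
  shows "tf_isomorphism G H \<beta> \<alpha>"
  using assms unfolding tf_isomorphism_def by (metis symE)

lemma restrict_comp_inject:
  assumes "\<phi> ` A = B" "f \<in> B \<rightarrow>\<^sub>E C" "f' \<in> B \<rightarrow>\<^sub>E C"
    and eq: "restrict (f \<circ> \<phi>) A = restrict (f' \<circ> \<phi>) A"
  shows "f = f'"
proof (rule PiE_ext[OF assms(2,3)])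
  fix x assume "x \<in> B"
  then obtain y where "y \<in> A" "x = \<phi> y" using assms(1) by blast
  with fun_cong[OF eq, of y] show "f x = f' x" by simp
qed

text \<open>Pulling back is injective because both maps are onto. The swapped TF-isomorphism handles
  the second balance condition, and \<open>\<alpha> = \<beta>\<close> keeps diagonal pairs
  diagonal.\<close>

lemma card_balanced_pairs_le:
  assumes iso: "tf_isomorphism G H \<alpha> \<beta>" and d: "d \<longrightarrow> \<alpha> = \<beta>"
    and G: "parcs G \<subseteq> pverts G \<times> pverts G" "sym (parcs G)" "finite (pverts G)"
    and H: "parcs H \<subseteq> pverts H \<times> pverts H" "sym (parcs H)"
  shows "card (balanced_pairs H d) \<le> card (balanced_pairs G d)"
proof (rule card_inj_on_le[where f = "\<lambda>(f, g). (restrict (f \<circ> \<beta>) (pverts G), restrict (g \<circ> \<alpha>) (pverts G))"])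
  note swap = tf_isomorphism_swap[OF iso G(2) H(2)]
  have img: "\<alpha> ` pverts G = pverts H" "\<beta> ` pverts G = pverts H"
    using iso by (auto simp: tf_isomorphism_def bij_betw_def)
  show "inj_on (\<lambda>(f, g). (restrict (f \<circ> \<beta>) (pverts G), restrict (g \<circ> \<alpha>) (pverts G))) (balanced_pairs H d)"
  proof (rule inj_onI, clarify)
    fix f g f' g'
    assume "(f, g) \<in> balanced_pairs H d" "(f', g') \<in> balanced_pairs H d"
      "restrict (f \<circ> \<beta>) (pverts G) = restrict (f' \<circ> \<beta>) (pverts G)"
      "restrict (g \<circ> \<alpha>) (pverts G) = restrict (g' \<circ> \<alpha>) (pverts G)"
    then show "f = f' \<and> g = g'"
      using restrict_comp_inject[OF img(2), of f _ f'] restrict_comp_inject[OF img(1), of g _ g']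
      by (auto simp: balanced_pairs_def)
  qed
  have into: "restrict (f \<circ> \<phi>) (pverts G) \<in> pverts G \<rightarrow>\<^sub>E {0, 1, 2}"
    if "f \<in> pverts H \<rightarrow>\<^sub>E {0, 1, 2}" "\<phi> ` pverts G = pverts H" for f :: "_ \<Rightarrow> int" and \<phi>
  proof (rule restrict_PiE_iff[THEN iffD2], rule ballI)
    fix i assume "i \<in> pverts G"
    with that show "(f \<circ> \<phi>) i \<in> {0, 1, 2}" unfolding o_apply by (intro PiE_mem[OF that(1)]) auto
  qed
  show "(\<lambda>(f, g). (restrict (f \<circ> \<beta>) (pverts G), restrict (g \<circ> \<alpha>) (pverts G))) ` balanced_pairs H d
      \<subseteq> balanced_pairs G d"
  proof (rule image_subsetI, clarify)
    fix f g assume fg: "(f, g) \<in> balanced_pairs H d"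
    then have "balanced H f g" "balanced H g f" "f \<in> pverts H \<rightarrow>\<^sub>E {0, 1, 2}" "g \<in> pverts H \<rightarrow>\<^sub>E {0, 1, 2}"
      "d \<longrightarrow> f = g"
      by (auto simp: balanced_pairs_def)
    moreover from this have "balanced G (restrict (f \<circ> \<beta>) (pverts G)) (restrict (g \<circ> \<alpha>) (pverts G))"
      "balanced G (restrict (g \<circ> \<alpha>) (pverts G)) (restrict (f \<circ> \<beta>) (pverts G))"
      using balanced_pullback[OF iso G(1) H(1)] balanced_pullback[OF swap G(1) H(1)] by blast+
    ultimately show "(restrict (f \<circ> \<beta>) (pverts G), restrict (g \<circ> \<alpha>) (pverts G)) \<in> balanced_pairs G d"
      using into img d unfolding balanced_pairs_def by simp
  qed
qed (use G in \<open>simp add: finite_balanced_pairs\<close>)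

section \<open>Antipodal symmetry of balanced pairs on the long circuit\<close>

text \<open>Each shift by three exchanges the two sequences modulo 3, so the parity of
  \<open>j\<close> decides which one is reached.\<close>

lemma alternating_recurrence:
  fixes x y :: "nat \<Rightarrow> int"
  assumes xy: "\<And>k. 3 dvd y (k + 1) + x k + x (k + 2)" and yx: "\<And>k. 3 dvd x (k + 1) + y k + y (k + 2)"
  shows "3 dvd x (k + 3 * j) - (if even j then x k else y k)"
proof -
  \<comment> \<open>The relation \<open>xy\<close> at \<open>k\<close> and the relation
    \<open>yx\<close> at \<open>k + 1\<close> share the terms \<open>y (k + 1) + x (k + 2)\<close>;
    subtracting leaves \<open>y (k + 3) - x k\<close>. The other half is symmetric.\<close>
  have *: "3 dvd y (k + 3) - x k \<and> 3 dvd x (k + 3) - y k" for k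
    using xy[of k] yx[of "k + 1"] yx[of k] xy[of "k + 1"] by (simp add: eval_nat_numeral) presburger
  have "3 dvd x (k + 3 * j) - (if even j then x k else y k) \<and>
      3 dvd y (k + 3 * j) - (if even j then y k else x k)" for j
  proof (induction j)
    case (Suc j)
    have "k + 3 * Suc j = k + 3 * j + 3" by simp
    then show ?case using Suc *[of "k + 3 * j"] by (simp only: even_Suc) (auto; presburger)
  qed simp
  then show ?thesis by blast
qed

lemma circ_in_verts: "n > 0 \<Longrightarrow> circ n k \<in> claw_verts n"
  by (simp add: claw_verts_eq)

text \<open>The flag \<open>odd n\<close> imposes \<open>f = g\<close> exactly when \<open>x\<^bsub>k+3n\<^esub>\<close> would otherwise be \<open>y\<^sub>k\<close> instead of \<open>x\<^sub>k\<close>.\<close>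

lemma balanced_pairs_CG_antipodal:
  assumes n: "n > 0" and fg: "(f, g) \<in> balanced_pairs (CG n) (odd n)"
  shows "f (circ n (k + 3 * n)) = f (circ n k)"
proof -
  define x where "x k = f (circ n k) - f (circ n (k + 3 * n))" for k
  define y where "y k = g (circ n k) - g (circ n (k + 3 * n))" for k
  have diff: "3 dvd (q (circ n (k + 1)) - q (circ n (k + 1 + 3 * n)))
      + (p (circ n k) - p (circ n (k + 3 * n))) + (p (circ n (k + 2)) - p (circ n (k + 2 + 3 * n)))"
    if "balanced (CG n) p q" for p q k
  proof -
    have "3 dvd q (circ n (k + 1)) + (p (circ n k) + p (circ n (k + 2)) + p (foot n (k + 1)))" for k
      using that circ_in_verts[OF n, of "k + 1"] sum_neighbours_circ[OF n, where k = k and f = p]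
      unfolding balanced_def pverts_CG by metis
    \<comment> \<open>Antipodal circuit vertices share their leaf, so its label cancels in the
      difference.\<close>
    from this[of k] this[of "k + 3 * n"] show ?thesis
      using foot_add_half[of n "k + 1"] by (simp add: ac_simps del: foot_add_half) presburger
  qed
  have "3 dvd y (k + 1) + x k + x (k + 2)" "3 dvd x (k + 1) + y k + y (k + 2)" for k
    using fg diff[of f g k] diff[of g f k] by (auto simp: balanced_pairs_def x_def y_def)
  then have "3 dvd x (k + 3 * n) - (if even n then x k else y k)"
    by (rule alternating_recurrence)
  moreover have "odd n \<Longrightarrow> x k = y k" using fg by (simp add: balanced_pairs_def x_def y_def)
  moreover have "x (k + 3 * n) = - x k"
    using circ_add_full[of n k] by (simp add: x_def add.assoc del: circ_add_full)
  ultimately have "3 dvd - x k - x k" by (cases "even n") auto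
  then have "3 dvd x k" by presburger
  \<comment> \<open>Labels in \<open>{0, 1, 2}\<close> differ by less than 3, which turns the
    congruence into an equality.\<close>
  moreover have "f \<in> claw_verts n \<rightarrow>\<^sub>E {0, 1, 2}" using fg by (simp add: balanced_pairs_def)
  then have "f (circ n k) \<in> {0, 1, 2}" "f (circ n (k + 3 * n)) \<in> {0, 1, 2}"
    using circ_in_verts[OF n] by (auto intro: PiE_mem)
  ultimately show ?thesis by (auto simp: x_def)
qed

lemma periodic_mod:
  assumes "\<And>k. h (k + p) = h k"
  shows "h (k mod p) = h (k :: nat)"
proof -
  have "h (r + q * p) = h r" for r q
    by (induction q) (use assms in \<open>simp_all add: add.assoc[symmetric] add.commute[of p]\<close>)
  from this[of "k mod p" "k div p"] show ?thesis by simp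
qed

lemma circ_Suc_exhaust:
  assumes "n > 0"
  obtains l where "circ n k = circ n (l + 1)"
proof
  \<comment> \<open>Adding a full turn first keeps the subtraction from truncating at
    \<open>k = 0\<close>.\<close>
  show "circ n k = circ n (k + 6 * n - 1 + 1)" using assms by (simp add: circ_def)
qed

text \<open>A circuit vertex gets the same successor index in both coordinate systems, the form that
  both neighbourhood sums require.\<close>

lemma claw_verts_cases:
  assumes "n > 0" "v \<in> claw_verts n"
  obtains (circuit) a k where "v = circ n (k + 1)" "v = pos n a (k + 1)"
    | (leaf) k where "v = foot n k" | (centre) i where "v = Centre i" "i < n"
proof -
  consider k where "v = circ n k" | k where "v = foot n k" | i where "v = Centre i" "i < n"
    using assms by (auto simp: claw_verts_eq)
  then show thesis
  proof cases
    case (1 k)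
    then obtain l where "v = circ n (l + 1)" using circ_Suc_exhaust[OF assms(1)] by metis
    then show thesis using circ_eq_pos[OF assms(1), of "l + 1"] circuit by metis
  qed (use leaf centre in blast)+
qed

section \<open>Transfer to the companion and its additional solution\<close>

text \<open>On the circuit \<open>f\<close> depends only on the index modulo \<open>3 * n\<close>,
  so the sums agree in both graphs even where the neighbours differ.\<close>

lemma balanced_CG'_if_antipodal:
  assumes n: "n > 0" and f: "\<And>k. f (circ n (k + 3 * n)) = f (circ n k)"
    and fg: "balanced (CG n) f g"
  shows "balanced (CG' n) f g"
  unfolding balanced_def pverts_CG
proof
  have pos: "f (pos n a k) = f (circ n k)" for a k
  proof -
    obtain l where "pos n a k = circ n l" "l mod (3 * n) = k mod (3 * n)"
      using pos_eq_circ[OF n] by blast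
    then show ?thesis using periodic_mod[of "\<lambda>k. f (circ n k)" "3 * n"] f by metis
  qed
  fix v assume v: "v \<in> claw_verts n"
  from n v show "3 dvd g v + (\<Sum>w | (v, w) \<in> parcs (CG' n). f w)"
  proof (cases rule: claw_verts_cases)
    case (circuit a k)
    have "(\<Sum>w | (v, w) \<in> parcs (CG' n). f w) = (\<Sum>w | (v, w) \<in> parcs (CG n). f w)"
      using sum_neighbours_pos[OF n, where a = a and k = k and f = f, folded circuit(2)]
        sum_neighbours_circ[OF n, where k = k and f = f, folded circuit(1)] by (simp only: pos)
    then show ?thesis using fg v unfolding balanced_def pverts_CG by metis
  next
    case (leaf k)
    then have "v \<notin> range Circuit" by (auto simp: foot_def)
    then show ?thesis using fg v by (simp add: balanced_def neighbours_CG'_eq_CG)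
  next
    case (centre i)
    then have "v \<notin> range Circuit" by auto
    then show ?thesis using fg v by (simp add: balanced_def neighbours_CG'_eq_CG)
  qed
qed

definition circuit_colour :: "nat \<Rightarrow> claw_vertex \<Rightarrow> int" where
  "circuit_colour n = (\<lambda>v\<in>claw_verts n. if v \<in> range (pos n 0) then 1 else if v \<in> range (pos n 1) then 2 else 0)"

lemma pos_in_verts: "n > 0 \<Longrightarrow> pos n a k \<in> claw_verts n"
  by (metis circ_in_verts pos_eq_circ)

lemma circuit_colour_pos:
  assumes "n > 0"
  shows "circuit_colour n (pos n a k) = 1 + int (a mod 2)"
proof -
  have "pos n a k \<in> range (pos n b) \<longleftrightarrow> a mod 2 = b mod 2" for b
    using assms by (auto simp: pos_eq_iff image_iff)
  then show ?thesis using assms by (simp add: circuit_colour_def pos_in_verts)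
qed

lemma circuit_colour_else:
  assumes "n > 0"
  shows "circuit_colour n (foot n k) = 0" "i < n \<Longrightarrow> circuit_colour n (Centre i) = 0"
  using assms by (auto simp: circuit_colour_def claw_verts_eq image_iff)

lemma pair_wf_digraph_CG:
  assumes "n > 0"
  shows "pair_wf_digraph (CG n)" "pair_wf_digraph (CG' n)"
proof -
  interpret G: pair_graph "CG n" using pair_graph_CG(1)[OF assms] .
  interpret H: pair_graph "CG' n" using pair_graph_CG(2)[OF assms] .
  show "pair_wf_digraph (CG n)" "pair_wf_digraph (CG' n)" by unfold_locales
qed

lemma arcs_CG:
  assumes "n > 0"
  shows "parcs (CG n) \<subseteq> claw_verts n \<times> claw_verts n" "sym (parcs (CG n))"
    "parcs (CG' n) \<subseteq> claw_verts n \<times> claw_verts n" "sym (parcs (CG' n))"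
proof -
  note wf = pair_wf_digraph_CG[OF assms]
  show "parcs (CG n) \<subseteq> claw_verts n \<times> claw_verts n" "parcs (CG' n) \<subseteq> claw_verts n \<times> claw_verts n"
    using wf[THEN pair_wf_digraph.arc_fst_in_verts] wf[THEN pair_wf_digraph.arc_snd_in_verts] by fastforce+
  show "sym (parcs (CG n))" "sym (parcs (CG' n))"
    by (auto simp: sym_def CG_def CG'_def undirected_graph_def insert_commute)
qed

text \<open>A circuit vertex of colour \<open>c\<close> and its two circuit neighbours give
  \<open>3 * c\<close>, a leaf sees 1 and 2, and a centre sees only zeros.\<close>

lemma circuit_colour_balanced:
  assumes n: "n > 0"
  shows "balanced (CG' n) (circuit_colour n) (circuit_colour n)"
  unfolding balanced_def pverts_CG
proof
  fix v assume "v \<in> claw_verts n"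
  with n show "3 dvd circuit_colour n v + (\<Sum>w | (v, w) \<in> parcs (CG' n). circuit_colour n w)"
  proof (cases rule: claw_verts_cases)
    case (circuit a k)
    show ?thesis
      unfolding circuit(2) sum_neighbours_pos[OF n] circuit_colour_pos[OF n] circuit_colour_else[OF n]
      by presburger
  next
    case (leaf k)
    have "pos n 0 k \<noteq> pos n 1 k" using n by (simp add: pos_eq_iff)
    then show ?thesis
      unfolding leaf neighbours_foot[OF n] using n by (simp add: circuit_colour_pos circuit_colour_else)
  next
    case (centre i)
    have "circuit_colour n w = 0" if "(v, w) \<in> parcs (CG' n)" for w
    proof -
      from that centre obtain j where "j < 3" "w = Leaf i j"
        unfolding parcs_CG'[OF n] by (auto simp: doubleton_eq_iff)
      then show ?thesis using leaf_eq_foot[OF centre(2)] circuit_colour_else(1)[OF n] by simp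
    qed
    then show ?thesis using centre n by (simp add: circuit_colour_else)
  qed
qed

lemma balanced_pairs_CG_psubset:
  assumes n: "n > 0"
  shows "balanced_pairs (CG n) (odd n) \<subset> balanced_pairs (CG' n) (odd n)"
proof (rule psubsetI)
  show "balanced_pairs (CG n) (odd n) \<subseteq> balanced_pairs (CG' n) (odd n)"
  proof clarify
    fix f g assume fg: "(f, g) \<in> balanced_pairs (CG n) (odd n)"
    \<comment> \<open>Antipodal symmetry was shown for the first component only; exchanging the
      components yields it for the second.\<close>
    have swap: "(q, p) \<in> balanced_pairs (CG n) (odd n)"
      if "(p, q) \<in> balanced_pairs (CG n) (odd n)" for p q
      using that by (auto simp: balanced_pairs_def)
    have "balanced (CG' n) p q" if "(p, q) \<in> balanced_pairs (CG n) (odd n)" for p q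
      using balanced_CG'_if_antipodal[OF n, of p q] balanced_pairs_CG_antipodal[OF n that] that
      by (simp add: balanced_pairs_def)
    from this[OF fg] this[OF swap[OF fg]] show "(f, g) \<in> balanced_pairs (CG' n) (odd n)"
      using fg by (simp add: balanced_pairs_def)
  qed
  let ?c = "circuit_colour n"
  have "(?c, ?c) \<in> balanced_pairs (CG' n) (odd n)"
    using circuit_colour_balanced[OF n] by (simp add: balanced_pairs_def) (simp add: circuit_colour_def)
  \<comment> \<open>Antipodal vertices of the long circuit lie on different short circuits, so the
    colouring separates them.\<close>
  moreover have "?c (circ n (0 + 3 * n)) \<noteq> ?c (circ n 0)"
  proof -
    have "circ n (0 + 3 * n) = pos n 1 0" "circ n 0 = pos n 0 0"
      using n by (simp_all add: circ_def pos_def)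
    then show ?thesis using circuit_colour_pos[OF n] by simp
  qed
  then have "(?c, ?c) \<notin> balanced_pairs (CG n) (odd n)"
    using balanced_pairs_CG_antipodal[OF n] by blast
  ultimately show "balanced_pairs (CG n) (odd n) \<noteq> balanced_pairs (CG' n) (odd n)" by blast
qed

text \<open>One count serves both purposes: for even \<open>n\<close> every TF-isomorphism is
  excluded, for odd \<open>n\<close> every ordinary isomorphism. The negated conclusion is exactly
  the side condition for comparing cardinalities with the flag \<open>odd n\<close>.\<close>

lemma no_tf_isomorphism:
  assumes n: "n > 0" and iso: "tf_isomorphism (CG n) (CG' n) \<alpha> \<beta>"
  shows "odd n \<and> \<alpha> \<noteq> \<beta>"
proof (rule ccontr)
  assume "\<not> ?thesis"
  then have "odd n \<longrightarrow> \<alpha> = \<beta>" by blast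
  then have "card (balanced_pairs (CG' n) (odd n)) \<le> card (balanced_pairs (CG n) (odd n))"
    using card_balanced_pairs_le[OF iso] arcs_CG[OF n] card_claw_verts(1) by simp
  moreover have "card (balanced_pairs (CG n) (odd n)) < card (balanced_pairs (CG' n) (odd n))"
    using balanced_pairs_CG_psubset[OF n] by (intro psubset_card_mono finite_balanced_pairs) (simp add: card_claw_verts)
  ultimately show False by simp
qed

section \<open>The TF-isomorphism for odd \<open>n\<close>\<close>

text \<open>Since \<open>pos\<close> reads its circuit argument modulo 2, \<open>m + c\<close>
  selects by parity; \<open>c = 0\<close> gives \<open>\<alpha>\<close> and \<open>c = 1\<close>
  gives \<open>\<beta>\<close>.\<close>

fun spread :: "nat \<Rightarrow> nat \<Rightarrow> claw_vertex \<Rightarrow> claw_vertex" where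
  "spread n c (Circuit m) = pos n (m + c) m"
| "spread n c v = v"

lemma pos_cong:
  "a mod 2 = b mod 2 \<Longrightarrow> k mod (3 * n) = l mod (3 * n) \<Longrightarrow> pos n a k = pos n b l"
  by (simp add: pos_def)

text \<open>Parity and residue modulo \<open>3 * n\<close> survive reduction modulo
  \<open>6 * n\<close>, as 2 and \<open>3 * n\<close> divide it.\<close>

lemma spread_circ: "spread n c (circ n k) = pos n (k + c) k"
proof -
  have "3 * n dvd 6 * n" "2 dvd 6 * n" by (simp_all add: mult_dvd_mono)
  then have "k mod (6 * n) mod (3 * n) = k mod (3 * n)" "(k mod (6 * n) + c) mod 2 = (k + c) mod 2"
    using mod_add_cancel[of "k mod (6 * n)" c 2 k] by (simp_all only: mod_mod_cancel)
  then show ?thesis unfolding circ_def spread.simps by (intro pos_cong)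
qed

lemma spread_foot [simp]: "spread n c (foot n k) = foot n k"
  by (simp add: foot_def)

text \<open>For odd \<open>n\<close> the moduli 2 and \<open>3 * n\<close> are coprime, so parity
  and position determine an index modulo \<open>6 * n\<close>. Injectivity of a self-map of a finite
  set suffices.\<close>

lemma bij_betw_spread:
  assumes n: "odd n"
  shows "bij_betw (spread n c) (claw_verts n) (claw_verts n)"
proof -
  have pos_n: "n > 0" using n by (simp add: odd_pos)
  have into: "spread n c ` claw_verts n \<subseteq> claw_verts n"
    using pos_n pos_in_verts by (auto simp: claw_verts_def)
  have circuit: "k = l" if "pos n (k + c) k = pos n (l + c) l" "k < 6 * n" "l < 6 * n" for k l
  proof -
    have "[k = l] (mod 2)" "[k = l] (mod 3 * n)"
      using that(1) mod_add_cancel[of k c 2 l] by (simp_all only: cong_def pos_eq_iff[OF pos_n])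
    moreover have "coprime 2 (3 * n)" using n by simp
    ultimately have "[k = l] (mod 2 * (3 * n))" by (rule coprime_cong_mult_nat)
    then show ?thesis using that by (simp add: cong_def)
  qed
  have "inj_on (spread n c) (claw_verts n)"
  proof (rule inj_onI)
    fix u v assume "u \<in> claw_verts n" "v \<in> claw_verts n" "spread n c u = spread n c v"
    then show "u = v" by (cases u; cases v) (auto simp: claw_verts_def dest: circuit)
  qed
  then show ?thesis
    using endo_inj_surj[OF card_claw_verts(1) into] by (simp add: bij_betw_def)
qed

text \<open>Adding the odd number \<open>3 * n\<close> flips the parity and keeps the
  position.\<close>

lemma lift_parity:
  assumes "odd n"
  obtains l where "l mod (3 * n) = k mod (3 * n)" "l mod 2 = a mod (2 :: nat)"
proof (cases "k mod 2 = a mod 2")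
  case False
  then have "(k + 3 * n) mod 2 = a mod 2" using assms by presburger
  then show thesis using that[of "k + 3 * n"] by simp
qed (use that in blast)

lemma tf_isomorphism_spread:
  assumes n: "odd n"
  shows "tf_isomorphism (CG n) (CG' n) (spread n 0) (spread n 1)"
proof -
  have pos_n: "n > 0" using n by (simp add: odd_pos)
  note bij = bij_betw_spread[OF n]
  have forward: "(spread n 0 u, spread n 1 v) \<in> parcs (CG' n)" if uv: "(u, v) \<in> parcs (CG n)" for u v
  proof -
    from uv consider k where "u = circ n k" "v = circ n (k + 1)" | k where "u = circ n (k + 1)" "v = circ n k"
      | i j where "i < n" "j < 3" "{u, v} = {Centre i, Leaf i j}"
      | k where "u = foot n k" "v = circ n k" | k where "u = circ n k" "v = foot n k"
      unfolding parcs_CG[OF pos_n] doubleton_eq_iff by blast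
    then show ?thesis
    proof cases
      case (1 k)
      \<comment> \<open>The offset of the second map compensates the step: \<open>k + 1 + 1\<close>
        has the parity of \<open>k\<close>, so both ends lie on the same short circuit.\<close>
      have "spread n 1 v = pos n k (k + 1)" unfolding 1 spread_circ by (rule pos_cong) simp_all
      then have "{spread n 0 u, spread n 1 v} = {pos n k k, pos n k (k + 1)}" by (simp add: 1 spread_circ)
      then show ?thesis unfolding parcs_CG'[OF pos_n] by blast
    next
      case (2 k)
      have "{spread n 0 u, spread n 1 v} = {pos n (k + 1) k, pos n (k + 1) (k + 1)}"
        by (simp add: 2 spread_circ insert_commute)
      then show ?thesis unfolding parcs_CG'[OF pos_n] by blast
    next
      case (3 i j)
      then have "{spread n 0 u, spread n 1 v} = {Centre i, Leaf i j}" by (auto simp: doubleton_eq_iff)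
      then show ?thesis unfolding parcs_CG'[OF pos_n] using 3 by blast
    next
      case (4 k)
      then have "{spread n 0 u, spread n 1 v} = {foot n k, pos n (k + 1) k}" by (simp add: spread_circ)
      then show ?thesis unfolding parcs_CG'[OF pos_n] by blast
    next
      case (5 k)
      then have "{spread n 0 u, spread n 1 v} = {foot n k, pos n k k}" by (simp add: spread_circ insert_commute)
      then show ?thesis unfolding parcs_CG'[OF pos_n] by blast
    qed
  qed
  have backward: "\<exists>u v. (u, v) \<in> parcs (CG n) \<and> spread n 0 u = u' \<and> spread n 1 v = v'"
    if uv: "(u', v') \<in> parcs (CG' n)" for u' v'
  proof -
    have arc: "(circ n k, circ n (k + 1)) \<in> parcs (CG n)" "(circ n (k + 1), circ n k) \<in> parcs (CG n)"
      "(foot n k, circ n k) \<in> parcs (CG n)" "(circ n k, foot n k) \<in> parcs (CG n)" for k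
      unfolding parcs_CG[OF pos_n] by blast+
    have Suc_mod: "(l + 1) mod m = (k + 1) mod m" if "l mod m = k mod m" for k l m :: nat
      using that by (simp only: mod_add_cancel)
    from uv consider a k where "u' = pos n a k" "v' = pos n a (k + 1)" | a k where "u' = pos n a (k + 1)" "v' = pos n a k"
      | i j where "i < n" "j < 3" "{u', v'} = {Centre i, Leaf i j}"
      | a k where "u' = foot n k" "v' = pos n a k" | a k where "u' = pos n a k" "v' = foot n k"
      unfolding parcs_CG'[OF pos_n] doubleton_eq_iff by blast
    then show ?thesis
    proof cases
      case (1 a k)
      obtain l where l: "l mod (3 * n) = k mod (3 * n)" "l mod 2 = a mod 2"
        using lift_parity[OF n] by blast
      have "spread n 0 (circ n l) = u'" "spread n 1 (circ n (l + 1)) = v'"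
        unfolding 1 spread_circ using l by (auto intro!: pos_cong Suc_mod[unfolded Suc_eq_plus1[symmetric]])
      then show ?thesis using arc(1) by blast
    next
      case (2 a k)
      \<comment> \<open>Here index \<open>l\<close> passes through the second map, which adds 1
        before taking the parity, so \<open>l\<close> must have the parity opposite to
        \<open>a\<close>.\<close>
      obtain l where l: "l mod (3 * n) = k mod (3 * n)" "l mod 2 = (a + 1) mod 2"
        using lift_parity[OF n] by blast
      have "(l + 1) mod 2 = a mod 2" using l(2) by presburger
      then have "spread n 0 (circ n (l + 1)) = u'" "spread n 1 (circ n l) = v'"
        unfolding 2 spread_circ add_0_right using l(1) Suc_mod[OF l(1)] by (blast intro: pos_cong)+
      then show ?thesis using arc(2) by blast
    next
      case (3 i j)
      then have "(u', v') \<in> parcs (CG n)" unfolding parcs_CG[OF pos_n] by blast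
      moreover have "spread n 0 u' = u'" "spread n 1 v' = v'" using 3 by (auto simp: doubleton_eq_iff)
      ultimately show ?thesis by blast
    next
      case (4 a k)
      obtain l where l: "l mod (3 * n) = k mod (3 * n)" "l mod 2 = (a + 1) mod 2"
        using lift_parity[OF n] by blast
      have "(l + 1) mod 2 = a mod 2" using l(2) by presburger
      then have "spread n 0 (foot n l) = u'" "spread n 1 (circ n l) = v'"
        unfolding 4 spread_circ spread_foot using l(1) by (blast intro: pos_cong foot_cong)+
      then show ?thesis using arc(3) by blast
    next
      case (5 a k)
      obtain l where l: "l mod (3 * n) = k mod (3 * n)" "l mod 2 = a mod 2"
        using lift_parity[OF n] by blast
      then have "spread n 0 (circ n l) = u'" "spread n 1 (foot n l) = v'"
        unfolding 5 spread_circ spread_foot add_0_right by (blast intro: pos_cong foot_cong)+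
      then show ?thesis using arc(4) by blast
    qed
  qed
  \<comment> \<open>Arcs are reflected because every arc of the companion comes from an arc and
    injectivity of both maps makes its preimage unique.\<close>
  have "(u, v) \<in> parcs (CG n)"
    if uv: "u \<in> claw_verts n" "v \<in> claw_verts n" and arc: "(spread n 0 u, spread n 1 v) \<in> parcs (CG' n)" for u v
  proof -
    obtain x y where xy: "(x, y) \<in> parcs (CG n)" "spread n 0 x = spread n 0 u" "spread n 1 y = spread n 1 v"
      using backward[OF arc] by blast
    then have "x \<in> claw_verts n" "y \<in> claw_verts n" using arcs_CG(1)[OF pos_n] by auto
    then have "x = u" "y = v"
      using xy uv inj_onD[OF bij_betw_imp_inj_on[OF bij]] by metis+
    with xy show ?thesis by simp
  qed
  with bij forward show ?thesis unfolding tf_isomorphism_def pverts_CG by blast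
qed

theorem proposition6p1:
  fixes n :: nat
  assumes "n > 0"
  shows "tf_cousins (CG n) (CG' n) \<longleftrightarrow> odd n"
proof
  assume "tf_cousins (CG n) (CG' n)"
  then show "odd n"
    using no_tf_isomorphism[OF assms] by (auto simp: tf_cousins_def tf_isomorphic_def)
next
  assume odd: "odd n"
  note wf = pair_wf_digraph_CG[OF assms]
  have "\<not> digraph_iso (with_proj (CG n)) (with_proj (CG' n))"
  proof
    assume "digraph_iso (with_proj (CG n)) (with_proj (CG' n))"
    then obtain f where "tf_isomorphism (CG n) (CG' n) f f"
      unfolding digraph_iso_with_proj_iff[OF wf] tf_isomorphism_def by blast
    with no_tf_isomorphism[OF assms] show False by blast
  qed
  with tf_isomorphism_spread[OF odd] show "tf_cousins (CG n) (CG' n)"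
    by (auto simp: tf_cousins_def tf_isomorphic_def)
qed

end
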